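(* The class $\mathcal{EC}_{<\omega}$ is preserved under continuous images: if $K\in\mathcal{EC}_{<\omega}$ and $\varphi:K\to L$ is a continuous surjection onto a (Tikhonov) space $L$, then $L\in\mathcal{EC}_{<\omega}$.
   Context: All topological spaces are assumed to be Tikhonov (completely regular Hausdorff). For a set $\Gamma$ and $n\in\omega$, $\sigma_n(\Gamma)$ denotes the subspace of the product $2^\Gamma$ (with $2=\{0,1\}$ discrete) consisting of all characteristic functions of subsets of $\Gamma$ of cardinality $\le n$. A compact space $K$ belongs to the class $\mathcal{EC}_n$ if $K$ can be (homeomorphically) embedded in $\sigma_n(\Gamma)$ for some set $\Gamma$. Put $\mathcal{EC}_{<\omega}=\bigcup_{n\in\omega}\mathcal{EC}_n$. *)

theory Defs
  imports "HOL-Analysis.Analysis"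
begin

definition tikhonov_space :: "'a topology \<Rightarrow> bool" where
  "tikhonov_space X \<longleftrightarrow> completely_regular_space X \<and> Hausdorff_space X"

text \<open>The product topology lives on extensional functions, so characteristic functions of
  subsets of \<open>\<Gamma>\<close> are restricted to \<open>\<Gamma>\<close>.\<close>

definition sigma_space :: "nat \<Rightarrow> 'g set \<Rightarrow> ('g \<Rightarrow> nat) topology" where
  "sigma_space n \<Gamma> =
     subtopology (product_topology (\<lambda>_. discrete_topology {0, 1}) \<Gamma>)
       {restrict (indicator A) \<Gamma> | A. A \<subseteq> \<Gamma> \<and> finite A \<and> card A \<le> n}"

text \<open>HOL cannot quantify over the type of the elements of \<open>\<Gamma>\<close>, so index sets are taken inside
  \<^typ>\<open>'a \<times> nat\<close>, where \<^typ>\<open>'a\<close> is the type of the points of the space. This is no restriction: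
  lemma \<open>EC_I\<close> below shows that a compact Tikhonov space that embeds into
  \<^term>\<open>sigma_space n \<Gamma>\<close> for a set \<open>\<Gamma>\<close> over any type whatsoever belongs to \<open>EC n\<close>.\<close>

definition EC :: "nat \<Rightarrow> 'a topology set" where
  "EC n = {K. tikhonov_space K \<and> compact_space K \<and>
             (\<exists>(\<Gamma> :: ('a \<times> nat) set) f. embedding_map K (sigma_space n \<Gamma>) f)}"

definition EC_fin :: "'a topology set" where
  "EC_fin = (\<Union>n. EC n)"

lemma topspace_sigma_space:
  "topspace (sigma_space n \<Gamma>) = {restrict (indicator A) \<Gamma> | A. A \<subseteq> \<Gamma> \<and> finite A \<and> card A \<le> n}"
  by (auto simp: sigma_space_def indicator_def)

lemma Hausdorff_sigma_space: "Hausdorff_space (sigma_space n \<Gamma>)"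
  by (simp add: sigma_space_def Hausdorff_space_subtopology Hausdorff_space_product_topology)

lemma EC_I:
  fixes K :: "'a topology" and \<Gamma> :: "'g set"
  assumes tik: "tikhonov_space K" and comp: "compact_space K"
    and emb: "embedding_map K (sigma_space n \<Gamma>) f"
  shows "K \<in> EC n"
proof -
  define s where "s x = {\<gamma>\<in>\<Gamma>. f x \<gamma> = 1}" for x
  have hom: "homeomorphic_map K (subtopology (sigma_space n \<Gamma>) (f ` topspace K)) f"
    using emb by (simp add: embedding_map_def)
  then have cont: "continuous_map K (sigma_space n \<Gamma>) f"
    using homeomorphic_imp_continuous_map[OF hom] by (simp add: continuous_map_in_subtopology)
  have inj: "inj_on f (topspace K)"
    using hom by (rule homeomorphic_imp_injective_map)
  have fx: "f x = restrict (indicator (s x)) \<Gamma> \<and> s x \<subseteq> \<Gamma> \<and> finite (s x) \<and> card (s x) \<le> n"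
    if x: "x \<in> topspace K" for x
  proof -
    have "f x \<in> topspace (sigma_space n \<Gamma>)"
      using continuous_map_funspace[OF cont] x by (rule Pi_mem)
    then obtain A where A: "f x = restrict (indicator A) \<Gamma>" "A \<subseteq> \<Gamma>" "finite A" "card A \<le> n"
      unfolding topspace_sigma_space by blast
    then have "s x = A" by (auto simp: s_def indicator_def split: if_splits)
    with A show ?thesis by simp
  qed
  define S where "S = (\<Union>x\<in>topspace K. s x)"
  have "S \<subseteq> \<Gamma>" using fx by (auto simp: S_def)
  have "\<forall>\<gamma>\<in>S. \<exists>x\<in>topspace K. \<gamma> \<in> s x" by (auto simp: S_def)
  then obtain p where p: "\<And>\<gamma>. \<gamma> \<in> S \<Longrightarrow> p \<gamma> \<in> topspace K \<and> \<gamma> \<in> s (p \<gamma>)" by metis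
  have "\<forall>x\<in>topspace K. \<exists>e :: 'g \<Rightarrow> nat. inj_on e (s x)"
    using fx finite_imp_inj_to_nat_seg by meson
  then obtain e :: "'a \<Rightarrow> 'g \<Rightarrow> nat" where e: "\<And>x. x \<in> topspace K \<Longrightarrow> inj_on (e x) (s x)" by metis
  define j where "j \<gamma> = (p \<gamma>, e (p \<gamma>) \<gamma>)" for \<gamma>
  have injj: "inj_on j S"
  proof (rule inj_onI)
    fix a b assume a: "a \<in> S" and b: "b \<in> S" and "j a = j b"
    then have pab: "p a = p b" and "e (p a) a = e (p b) b" unfolding j_def by blast+
    then have "e (p b) a = e (p b) b" by metis
    moreover have "inj_on (e (p b)) (s (p b))" using e p[OF b] by blast
    moreover have "a \<in> s (p b)" using p[OF a] pab by simp
    ultimately show "a = b" using p[OF b] by (auto dest: inj_onD)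
  qed
  define g where "g x = restrict (indicator (j ` s x) :: 'a \<times> nat \<Rightarrow> nat) (j ` S)" for x
  have sS: "s x \<subseteq> S" if "x \<in> topspace K" for x using that by (auto simp: S_def)
  have gj: "g x (j \<gamma>) = f x \<gamma>" if "x \<in> topspace K" "\<gamma> \<in> S" for x \<gamma>
  proof -
    have "j \<gamma> \<in> j ` s x \<longleftrightarrow> \<gamma> \<in> s x"
      by (rule inj_on_image_mem_iff[OF injj that(2) sS[OF that(1)]])
    with that fx[OF that(1)] \<open>S \<subseteq> \<Gamma>\<close> show ?thesis
      by (auto simp: g_def indicator_def)
  qed
  have "continuous_map K (sigma_space n (j ` S)) g"
    unfolding sigma_space_def continuous_map_in_subtopology continuous_map_componentwise
  proof (intro conjI ballI)
    show "g ` topspace K \<subseteq> extensional (j ` S)" by (auto simp: g_def)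
    show "g \<in> topspace K \<rightarrow> {restrict (indicator A) (j ` S) |A. A \<subseteq> j ` S \<and> finite A \<and> card A \<le> n}"
    proof
      fix x assume x: "x \<in> topspace K"
      have "j ` s x \<subseteq> j ` S" "finite (j ` s x)" "card (j ` s x) \<le> n"
        using sS[OF x] fx[OF x] card_image_le[of "s x" j] by auto
      then show "g x \<in> {restrict (indicator A) (j ` S) |A. A \<subseteq> j ` S \<and> finite A \<and> card A \<le> n}"
        unfolding g_def by blast
    qed
  next
    fix k assume "k \<in> j ` S"
    then obtain \<gamma> where \<gamma>: "k = j \<gamma>" "\<gamma> \<in> S" by blast
    have "continuous_map K (discrete_topology {0, 1}) (\<lambda>x. f x \<gamma>)"
      using cont \<gamma> \<open>S \<subseteq> \<Gamma>\<close>
      unfolding sigma_space_def continuous_map_in_subtopology continuous_map_componentwise by auto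
    then show "continuous_map K (discrete_topology {0, 1}) (\<lambda>x. g x k)"
      by (rule continuous_map_eq) (simp add: gj \<gamma>)
  qed
  moreover have "inj_on g (topspace K)"
  proof (rule inj_onI)
    fix x y assume x: "x \<in> topspace K" and y: "y \<in> topspace K" and eq: "g x = g y"
    have "f x \<gamma> = f y \<gamma>" if "\<gamma> \<in> S" for \<gamma>
      using gj[OF x that] gj[OF y that] eq by simp
    then have "s x = s y"
      using sS[OF x] sS[OF y] by (auto simp: s_def)
    then have "f x = f y" using fx[OF x] fx[OF y] by simp
    with inj x y show "x = y" by (simp add: inj_on_def)
  qed
  ultimately have "embedding_map K (sigma_space n (j ` S)) g"
    using comp Hausdorff_sigma_space by (intro continuous_imp_embedding_map)
  then show ?thesis using tik comp by (auto simp: EC_def)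
qed

end

theory Submission
  imports Defs
begin

text \<open>A compact Hausdorff space lies in \<^term>\<open>EC n\<close> exactly when it has a family of clopen sets
  such that any two points are told apart by a member of the family and no point lies in more
  than \<open>n\<close> members. So the task is to build such a family on \<open>L\<close> from one on \<open>K\<close>.

  Write \<open>s x\<close> for the support of \<open>x \<in> K\<close>, a finite set with at most \<open>n\<close> elements. For \<open>y \<in> L\<close> let
  \<open>W y\<close> be the set of all \<open>x \<in> K\<close> whose support contains the support of some point of the fibre of
  \<open>\<phi>\<close> over \<open>y\<close>. It is an open set containing this fibre. Since \<open>s x\<close> has at most \<open>2 ^ n\<close>
  subsets, and each is the support of at most one point, \<open>x\<close> lies in at most \<open>2 ^ n\<close> of the sets
  \<open>W y\<close>. As \<open>\<phi>\<close> is a closed map, \<open>G y = \<phi> ` (K - W y)\<close> is a closed set that misses \<open>y\<close>, and any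
  clopen neighbourhoods \<open>U y\<close> of \<open>y\<close> disjoint from \<open>G y\<close> form a family in which every point of
  \<open>L\<close> has multiplicity at most \<open>2 ^ n\<close>.

  Separation of points, and the existence of the clopen sets \<open>U y\<close>, both come from the rank of
  \<open>y\<close>, the least cardinality of a support in its fibre. If \<open>z \<noteq> y\<close> has rank at most that of \<open>y\<close>,
  then a point \<open>x\<close> over \<open>z\<close> of least support cannot lie in \<open>W y\<close>: its support would contain,
  hence by cardinality equal, the support of a point over \<open>y\<close>. So \<open>z \<in> G y\<close> (\<open>rank_le_shadow\<close>).
  Consequently \<open>U y\<close> separates \<open>y\<close> from every other point of no larger rank. Moreover a
  point \<open>y\<close> of greatest rank in a connected set \<open>C\<close> splits \<open>C\<close> into the disjoint closed parts \<open>{y}\<close>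
  and \<open>C \<inter> G y\<close>. Hence \<open>L\<close> is totally disconnected, and in a compact Hausdorff space this gives
  enough clopen sets. In particular \<open>L\<close> belongs to \<open>EC (2 ^ n)\<close>.\<close>

section \<open>Embeddings into \<open>\<sigma>\<^sub>n\<close> and point-bounded clopen families\<close>

lemma EC_imp_supports:
  fixes K :: "'a topology"
  assumes "K \<in> EC n"
  obtains s :: "'a \<Rightarrow> ('a \<times> nat) set"
  where "\<And>x. x \<in> topspace K \<Longrightarrow> finite (s x) \<and> card (s x) \<le> n"
    and "inj_on s (topspace K)"
    and "\<And>\<gamma>. openin K {x \<in> topspace K. \<gamma> \<in> s x}"
proof -
  obtain \<Gamma> :: "('a \<times> nat) set" and f where emb: "embedding_map K (sigma_space n \<Gamma>) f"
    using assms by (auto simp: EC_def)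
  define s where "s x = {\<gamma>\<in>\<Gamma>. f x \<gamma> = 1}" for x
  have hom: "homeomorphic_map K (subtopology (sigma_space n \<Gamma>) (f ` topspace K)) f"
    using emb by (simp add: embedding_map_def)
  then have cont: "continuous_map K (sigma_space n \<Gamma>) f"
    using homeomorphic_imp_continuous_map[OF hom] by (simp add: continuous_map_in_subtopology)
  have fx: "f x = restrict (indicator (s x)) \<Gamma> \<and> finite (s x) \<and> card (s x) \<le> n"
    if x: "x \<in> topspace K" for x
  proof -
    have "f x \<in> topspace (sigma_space n \<Gamma>)"
      using continuous_map_funspace[OF cont] x by (rule Pi_mem)
    then obtain A where A: "f x = restrict (indicator A) \<Gamma>" "A \<subseteq> \<Gamma>" "finite A" "card A \<le> n"
      unfolding topspace_sigma_space by blast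
    then have "s x = A" by (auto simp: s_def indicator_def split: if_splits)
    with A show ?thesis by simp
  qed
  have "inj_on s (topspace K)"
    using homeomorphic_imp_injective_map[OF hom] fx unfolding inj_on_def by metis
  moreover have "openin K {x \<in> topspace K. \<gamma> \<in> s x}" for \<gamma>
  proof (cases "\<gamma> \<in> \<Gamma>")
    case True
    then have "continuous_map K (discrete_topology {0, 1}) (\<lambda>x. f x \<gamma>)"
      using cont
      unfolding sigma_space_def continuous_map_in_subtopology continuous_map_componentwise by auto
    then have "openin K {x \<in> topspace K. f x \<gamma> \<in> {1}}"
      by (rule openin_continuous_map_preimage) simp
    then show ?thesis using True by (simp add: s_def)
  qed (simp add: s_def)
  ultimately show thesis using that fx by blast
qed

text \<open>The converse passage: the evaluation map of the family is the embedding.\<close>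

lemma EC_if_point_bounded_clopen_family:
  fixes L :: "'b topology" and U :: "'i \<Rightarrow> 'b set"
  assumes tik: "tikhonov_space L" and comp: "compact_space L"
    and clopen: "\<And>i. i \<in> I \<Longrightarrow> openin L (U i) \<and> closedin L (U i)"
    and bounded: "\<And>z. z \<in> topspace L \<Longrightarrow> finite {i\<in>I. z \<in> U i} \<and> card {i\<in>I. z \<in> U i} \<le> n"
    and separating: "\<And>y z. y \<in> topspace L \<Longrightarrow> z \<in> topspace L \<Longrightarrow> y \<noteq> z
      \<Longrightarrow> \<exists>i\<in>I. y \<in> U i \<longleftrightarrow> z \<notin> U i"
  shows "L \<in> EC n"
proof -
  define g where "g z = restrict (indicator {i\<in>I. z \<in> U i} :: 'i \<Rightarrow> nat) I" for z
  have "continuous_map L (sigma_space n I) g"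
    unfolding sigma_space_def continuous_map_in_subtopology continuous_map_componentwise
  proof (intro conjI ballI)
    show "g ` topspace L \<subseteq> extensional I" by (auto simp: g_def)
    show "g \<in> topspace L \<rightarrow> {restrict (indicator A) I |A. A \<subseteq> I \<and> finite A \<and> card A \<le> n}"
      unfolding g_def using bounded by blast
  next
    fix i assume i: "i \<in> I"
    show "continuous_map L (discrete_topology {0, 1}) (\<lambda>z. g z i)"
      unfolding continuous_map_def
    proof (intro conjI allI impI)
      show "(\<lambda>z. g z i) \<in> topspace L \<rightarrow> topspace (discrete_topology {0, 1})"
        using i by (auto simp: g_def indicator_def)
      fix V :: "nat set"
      have "{z \<in> topspace L. g z i \<in> V} =
          (if 1 \<in> V then U i else {}) \<union> (if 0 \<in> V then topspace L - U i else {})"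
        using i openin_subset[of L "U i"] clopen[OF i] by (auto simp: g_def indicator_def)
      then show "openin L {z \<in> topspace L. g z i \<in> V}"
        using clopen[OF i] by (simp add: openin_Un openin_diff)
    qed
  qed
  moreover have "inj_on g (topspace L)"
  proof (rule inj_onI, rule ccontr)
    fix y z assume "y \<in> topspace L" "z \<in> topspace L" "g y = g z" "y \<noteq> z"
    then obtain i where "i \<in> I" "y \<in> U i \<longleftrightarrow> z \<notin> U i" using separating by blast
    then show False
      using fun_cong[OF \<open>g y = g z\<close>, of i] by (auto simp: g_def indicator_def split: if_splits)
  qed
  ultimately have "embedding_map L (sigma_space n I) g"
    using comp Hausdorff_sigma_space by (intro continuous_imp_embedding_map)
  then show ?thesis using tik comp by (intro EC_I)
qed

section \<open>Total disconnectedness from a ranking\<close>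

text \<open>The hypothesis on \<open>r\<close> says that each point is isolated among the points of no larger rank,
  which is how finite Cantor-Bendixson height enters. A point of greatest rank in a connected
  set is therefore an isolated point of that set, so it is the only one.\<close>

lemma connectedin_ranked_subsingleton:
  fixes r :: "'b \<Rightarrow> nat"
  assumes haus: "Hausdorff_space X"
    and bounded: "\<And>y. y \<in> topspace X \<Longrightarrow> r y \<le> n"
    and closed: "\<And>y. y \<in> topspace X \<Longrightarrow> closedin X (G y) \<and> y \<notin> G y"
    and below: "\<And>y z. y \<in> topspace X \<Longrightarrow> z \<in> topspace X \<Longrightarrow> z \<noteq> y \<Longrightarrow> r z \<le> r y \<Longrightarrow> z \<in> G y"
    and conn: "connectedin X C"
    and a: "a \<in> C" and b: "b \<in> C"
  shows "a = b"
proof -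
  have sub: "C \<subseteq> topspace X" using conn by (rule connectedin_subset_topspace)
  have "\<forall>y. y \<in> C \<longrightarrow> r y < Suc n" using bounded sub by (auto simp: less_Suc_eq_le)
  then obtain y where y: "y \<in> C" and max: "\<And>z. z \<in> C \<Longrightarrow> r z \<le> r y"
    using Lattices_Big.ex_has_greatest_nat[of "\<lambda>y. y \<in> C" a r "Suc n"] a by blast
  have yX: "y \<in> topspace X" using y sub by blast
  then have "closedin X {y}" using haus by (simp add: closedin_Hausdorff_singleton)
  moreover have "closedin X (G y)" "y \<notin> G y" using closed yX by auto
  moreover have "C \<subseteq> {y} \<union> G y" using below[OF yX] max sub by blast
  ultimately have "G y \<inter> C = {}"
    using conn y unfolding connectedin_closedin by blast
  then show ?thesis using \<open>C \<subseteq> {y} \<union> G y\<close> a b by blast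
qed

lemma totally_disconnected_clopen_separation:
  assumes comp: "compact_space X" and haus: "Hausdorff_space X"
    and discon: "\<And>C a b. connectedin X C \<Longrightarrow> a \<in> C \<Longrightarrow> b \<in> C \<Longrightarrow> a = b"
    and y: "y \<in> topspace X" and G: "closedin X G" "y \<notin> G"
  obtains U where "openin X U" "closedin X U" "y \<in> U" "U \<inter> G = {}"
proof -
  have "separated_between X {y} G"
  proof (rule cut_wire_fence_theorem[OF comp haus _ G(1)])
    show "closedin X {y}" using haus y by (simp add: closedin_Hausdorff_singleton)
    fix C assume "connectedin X C"
    then show "disjnt C {y} \<or> disjnt C G"
      using discon G(2) by (auto simp: disjnt_iff)
  qed
  then obtain U where "closedin X U" "openin X U" "{y} \<subseteq> U" "G \<subseteq> topspace X - U"
    unfolding separated_between by blast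
  then show thesis using that by blast
qed

section \<open>Shadows of fibres\<close>

text \<open>The shadow of \<open>y\<close> is the image of the complement of \<open>W y\<close> in the notation above.\<close>

definition shadow :: "'a topology \<Rightarrow> ('a \<Rightarrow> 'g set) \<Rightarrow> ('a \<Rightarrow> 'b) \<Rightarrow> 'b \<Rightarrow> 'b set" where
  "shadow K s \<phi> y = \<phi> ` {x \<in> topspace K. \<forall>a\<in>topspace K. \<phi> a = y \<longrightarrow> \<not> s a \<subseteq> s x}"

definition fibre_rank :: "'a topology \<Rightarrow> ('a \<Rightarrow> 'g set) \<Rightarrow> ('a \<Rightarrow> 'b) \<Rightarrow> 'b \<Rightarrow> nat" where
  "fibre_rank K s \<phi> y = (LEAST k. \<exists>x\<in>topspace K. \<phi> x = y \<and> card (s x) = k)"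

lemma fibre_rank_attained:
  assumes "y \<in> \<phi> ` topspace K"
  obtains x where "x \<in> topspace K" "\<phi> x = y" "card (s x) = fibre_rank K s \<phi> y"
proof -
  have "\<exists>k. \<exists>x\<in>topspace K. \<phi> x = y \<and> card (s x) = k" using assms by blast
  then show thesis using that unfolding fibre_rank_def by (smt (verit) LeastI_ex)
qed

lemma fibre_rank_le: "a \<in> topspace K \<Longrightarrow> fibre_rank K s \<phi> (\<phi> a) \<le> card (s a)"
  unfolding fibre_rank_def by (rule Least_le) blast

lemma notin_shadow: "y \<notin> shadow K s \<phi> y"
  by (auto simp: shadow_def)

text \<open>Finiteness of supports makes the set of points whose support contains a given one a
  finite intersection of open sets.\<close>

lemma closedin_shadow:
  assumes comp: "compact_space K" and haus: "Hausdorff_space L" and cont: "continuous_map K L \<phi>"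
    and fin: "\<And>x. x \<in> topspace K \<Longrightarrow> finite (s x)"
    and op: "\<And>\<gamma>. openin K {x \<in> topspace K. \<gamma> \<in> s x}"
  shows "closedin L (shadow K s \<phi> y)"
proof -
  have "openin K {x \<in> topspace K. s a \<subseteq> s x}" if "a \<in> topspace K" for a
  proof -
    have "openin K {x \<in> topspace K. T \<subseteq> s x}" if "finite T" for T
      using that
    proof induction
      case (insert \<gamma> T)
      have "{x \<in> topspace K. insert \<gamma> T \<subseteq> s x} =
          {x \<in> topspace K. \<gamma> \<in> s x} \<inter> {x \<in> topspace K. T \<subseteq> s x}" by auto
      then show ?case using op insert.IH by (simp add: openin_Int)
    qed simp
    then show ?thesis using fin[OF that] .
  qed
  then have "openin K (\<Union>a\<in>{a\<in>topspace K. \<phi> a = y}. {x \<in> topspace K. s a \<subseteq> s x})"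
    by (intro openin_Union) auto
  then have "closedin K (topspace K - (\<Union>a\<in>{a\<in>topspace K. \<phi> a = y}. {x \<in> topspace K. s a \<subseteq> s x}))"
    by (rule closedin_diff[OF closedin_topspace])
  moreover have "shadow K s \<phi> y =
      \<phi> ` (topspace K - (\<Union>a\<in>{a\<in>topspace K. \<phi> a = y}. {x \<in> topspace K. s a \<subseteq> s x}))"
    unfolding shadow_def by (rule image_cong) auto
  ultimately show ?thesis
    using continuous_imp_closed_map[OF cont comp haus] by (simp add: closed_map_def)
qed

text \<open>A point of least support over \<open>z\<close> witnesses \<open>z\<close> in the shadow: if its support contained
  that of a point \<open>a\<close> over \<open>y\<close>, then comparing cardinalities would make the two supports, and
  so the two points, equal.\<close>

lemma rank_le_shadow:
  assumes fin: "\<And>x. x \<in> topspace K \<Longrightarrow> finite (s x)" and inj: "inj_on s (topspace K)"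
    and z: "z \<in> \<phi> ` topspace K" and "z \<noteq> y"
    and le: "fibre_rank K s \<phi> z \<le> fibre_rank K s \<phi> y"
  shows "z \<in> shadow K s \<phi> y"
proof -
  obtain x where x: "x \<in> topspace K" "\<phi> x = z" "card (s x) = fibre_rank K s \<phi> z"
    using fibre_rank_attained[OF z] .
  have "\<not> s a \<subseteq> s x" if a: "a \<in> topspace K" "\<phi> a = y" for a
  proof
    assume "s a \<subseteq> s x"
    moreover have "card (s x) \<le> card (s a)"
      using x(3) le fibre_rank_le[OF a(1), of s \<phi>] a(2) by simp
    ultimately have "s a = s x" using fin[OF x(1)] by (simp add: card_seteq)
    then show False using inj a x \<open>z \<noteq> y\<close> by (auto dest: inj_onD)
  qed
  then show ?thesis using x unfolding shadow_def by blast
qed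

text \<open>Fix \<open>x\<close> over \<open>z\<close>. Each \<open>y\<close> whose shadow misses \<open>z\<close> is the image of a point whose support
  is a subset of \<open>s x\<close>, and supports determine points.\<close>

lemma card_notin_shadow:
  assumes x: "x \<in> topspace K" and fin: "finite (s x)" and bound: "card (s x) \<le> n"
    and inj: "inj_on s (topspace K)"
  shows "finite {y. \<phi> x \<notin> shadow K s \<phi> y} \<and> card {y. \<phi> x \<notin> shadow K s \<phi> y} \<le> 2 ^ n"
proof -
  define A where "A = {a \<in> topspace K. s a \<subseteq> s x}"
  have injA: "inj_on s A" using inj by (rule inj_on_subset) (auto simp: A_def)
  have sA: "s ` A \<subseteq> Pow (s x)" by (auto simp: A_def)
  have finA: "finite A" using injA sA fin by (meson finite_Pow_iff inj_on_finite)
  have "card A \<le> card (Pow (s x))" using card_inj_on_le[OF injA sA] fin by simp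
  also have "\<dots> \<le> 2 ^ n" using fin bound by (simp add: card_Pow)
  finally have "card A \<le> 2 ^ n" .
  moreover have "{y. \<phi> x \<notin> shadow K s \<phi> y} \<subseteq> \<phi> ` A"
    using x by (auto simp: shadow_def A_def)
  ultimately show ?thesis
    using finA by (meson card_image_le card_mono finite_imageI finite_subset le_trans)
qed

section \<open>Continuous images\<close>

theorem corollary3p2:
  fixes K :: "'a topology" and L :: "'b topology" and \<phi> :: "'a \<Rightarrow> 'b"
  assumes "K \<in> EC_fin"
    and "tikhonov_space L"
    and "continuous_map K L \<phi>"
    and "\<phi> ` topspace K = topspace L"
  shows "L \<in> EC_fin"
proof -
  obtain n where K: "K \<in> EC n" using assms(1) by (auto simp: EC_fin_def)
  then have compK: "compact_space K" by (simp add: EC_def)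
  obtain s :: "'a \<Rightarrow> ('a \<times> nat) set"
    where s: "\<And>x. x \<in> topspace K \<Longrightarrow> finite (s x) \<and> card (s x) \<le> n"
      and inj: "inj_on s (topspace K)"
      and op: "\<And>\<gamma>. openin K {x \<in> topspace K. \<gamma> \<in> s x}"
    using EC_imp_supports[OF K] by blast
  have haus: "Hausdorff_space L" using assms(2) by (simp add: tikhonov_space_def)
  have compL: "compact_space L"
    using image_compactin[of K "topspace K" L \<phi>] compK assms(3,4) by (simp add: compact_space_def)
  let ?G = "shadow K s \<phi>" and ?r = "fibre_rank K s \<phi>"
  have closed: "closedin L (?G y)" for y
    using closedin_shadow[OF compK haus assms(3)] s op by blast
  have below: "z \<in> ?G y" if "z \<in> topspace L" "z \<noteq> y" "?r z \<le> ?r y" for y z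
    using rank_le_shadow[of K s z \<phi> y] s inj that assms(4) by blast
  have bounded: "?r y \<le> n" if "y \<in> topspace L" for y
    using fibre_rank_le[of _ K s \<phi>] s that unfolding assms(4)[symmetric] by (force intro: le_trans)
  have discon: "a = b" if "connectedin L C" "a \<in> C" "b \<in> C" for C a b
    using haus bounded _ _ that
    by (rule connectedin_ranked_subsingleton[where G = ?G]) (auto simp: closed notin_shadow below)
  have "\<exists>U. openin L U \<and> closedin L U \<and> y \<in> U \<and> U \<inter> ?G y = {}" if "y \<in> topspace L" for y
    by (rule totally_disconnected_clopen_separation[OF compL haus _ that closed notin_shadow])
      (use discon in blast)+
  then obtain U where U: "\<And>y. y \<in> topspace L \<Longrightarrow>
      openin L (U y) \<and> closedin L (U y) \<and> y \<in> U y \<and> U y \<inter> ?G y = {}"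
    by metis
  have "L \<in> EC (2 ^ n)"
  proof (rule EC_if_point_bounded_clopen_family[where I = "topspace L" and U = U])
    fix z assume z: "z \<in> topspace L"
    then obtain x where x: "x \<in> topspace K" "z = \<phi> x" using assms(4) by blast
    have "{y \<in> topspace L. z \<in> U y} \<subseteq> {y. z \<notin> ?G y}" using U by blast
    moreover have "finite {y. z \<notin> ?G y} \<and> card {y. z \<notin> ?G y} \<le> 2 ^ n"
      unfolding x(2) using card_notin_shadow[OF x(1) _ _ inj] s[OF x(1)] by blast
    ultimately show "finite {y \<in> topspace L. z \<in> U y} \<and> card {y \<in> topspace L. z \<in> U y} \<le> 2 ^ n"
      by (meson card_mono finite_subset le_trans)
  next
    fix y z assume yz: "y \<in> topspace L" "z \<in> topspace L" "y \<noteq> z"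
    \<comment> \<open>The neighbourhood chosen for the point of larger rank excludes the other point.\<close>
    then have "z \<in> ?G y \<or> y \<in> ?G z" using below by (metis nat_le_linear)
    then show "\<exists>i\<in>topspace L. y \<in> U i \<longleftrightarrow> z \<notin> U i" using U yz by blast
  qed (use U compL assms(2) in auto)
  then show ?thesis by (auto simp: EC_fin_def)
qed

end
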